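(* Each of the two $(0,1)$-matrices of degree $5$ $$\begin{bmatrix}1&0&1&1&1\\0&1&1&1&1\\1&1&1&1&0\\1&1&0&0&1\\1&1&0&0&1\end{bmatrix},\qquad \begin{bmatrix}1&0&1&1&1\\0&1&1&1&1\\1&1&1&1&1\\1&1&0&0&1\\1&1&0&0&1\end{bmatrix}$$ is equivalent to a symmetric matrix, is strongly quadrangular, and does not support unitaries.
   Context: Two $(0,1)$-matrices $M_1,M_2$ are equivalent if $PM_1Q=M_2$ for some permutation matrices $P,Q$. An $n\times n$ $(0,1)$-matrix $M$ supports unitaries if there exists an $n\times n$ complex unitary matrix $U$ such that, for all $i,j$, $U_{ij}\neq 0$ if and only if $M_{ij}=1$. $M$ is row-strongly-quadrangular if for every set $S$ of rows of $M$ (rows indexed by position) such that each $u\in S$ has another row $v\in S$, $v\neq u$, with $\langle u,v\rangle\neq 0$, the number of columns containing at least two ones within the rows of $S$ is at least $|S|$. $M$ is strongly quadrangular if both $M$ and its transpose $M^T$ are row-strongly-quadrangular. *)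

theory Defs
  imports
    "Jordan_Normal_Form.Matrix"
    "Jordan_Normal_Form.Determinant"
    "Jordan_Normal_Form.Schur_Decomposition"
begin

(* (0,1)-matrices are integer matrices with entries 0 and 1; rows and columns are indexed from 0. *)

definition zero_one_mat :: "int mat \<Rightarrow> bool" where
  "zero_one_mat M \<longleftrightarrow> elements_mat M \<subseteq> {0, 1}"

definition permutation_mat :: "nat \<Rightarrow> int mat \<Rightarrow> bool" where
  "permutation_mat n P \<longleftrightarrow>
    (\<exists>p. p permutes {..<n} \<and> P = mat n n (\<lambda>(i, j). if j = p i then 1 else 0))"

definition mat_equivalent :: "int mat \<Rightarrow> int mat \<Rightarrow> bool" where
  "mat_equivalent M1 M2 \<longleftrightarrow> zero_one_mat M1 \<and> zero_one_mat M2 \<and>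
    (\<exists>P Q. permutation_mat (dim_row M1) P \<and> permutation_mat (dim_col M1) Q \<and> P * M1 * Q = M2)"

definition symmetric_matrix :: "int mat \<Rightarrow> bool" where
  "symmetric_matrix M \<longleftrightarrow> transpose_mat M = M"

definition unitary_mat :: "complex mat \<Rightarrow> bool" where
  "unitary_mat U \<longleftrightarrow> square_mat U \<and>
    U * mat_adjoint U = 1\<^sub>m (dim_row U) \<and> mat_adjoint U * U = 1\<^sub>m (dim_row U)"

definition supports_unitaries :: "int mat \<Rightarrow> bool" where
  "supports_unitaries M \<longleftrightarrow>
    (\<exists>U \<in> carrier_mat (dim_row M) (dim_col M). unitary_mat U \<and>
      (\<forall>i < dim_row M. \<forall>j < dim_col M. U $$ (i, j) \<noteq> 0 \<longleftrightarrow> M $$ (i, j) = 1))"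

(* Sets of rows are sets of row indices, so equal rows in different positions are distinct. *)
definition row_strongly_quadrangular :: "int mat \<Rightarrow> bool" where
  "row_strongly_quadrangular M \<longleftrightarrow>
    (\<forall>S \<subseteq> {..<dim_row M}.
      (\<forall>u \<in> S. \<exists>v \<in> S. v \<noteq> u \<and> row M u \<bullet> row M v \<noteq> 0) \<longrightarrow>
      card S \<le> card {j. j < dim_col M \<and> 2 \<le> card {i \<in> S. M $$ (i, j) = 1}})"

definition strongly_quadrangular :: "int mat \<Rightarrow> bool" where
  "strongly_quadrangular M \<longleftrightarrow>
    row_strongly_quadrangular M \<and> row_strongly_quadrangular (transpose_mat M)"

end

theory Submission
  imports Defs
begin

text \<open>The two matrices differ only in row 2 and column 4. With that entry left as a variable \<open>x\<close> they
form one pattern, and each of the three arguments below works for \<open>x = 0\<close> and \<open>x = 1\<close> alike.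

Taking the rows in the order 0, 1, 3, 4, 2 makes the pattern symmetric.

Strong quadrangularity needs no inspection of all sets of rows. Every column of the pattern has
at least three ones and three columns have at least four, so a set of at least four rows meets
every column in two ones, and a set of three rows meets at least three columns in two ones. For
two rows the bound says that they share two columns, which is true of any two rows here, and
a single row fails the premise. The transpose has the same three properties, so the same argument
covers it.

No unitary has this pattern because of rows 0, 1, 3 and 4. Rows 3 and 4 live on the columns
0, 1, 4, where they are orthogonal to the traces of rows 0 and 1, which are \<open>(a, 0, b)\<close> and
\<open>(0, c, d)\<close> with \<open>a\<close>, \<open>c\<close> nonzero. Such traces are linearly independent and leave a single
direction in the three-dimensional space, so rows 3 and 4 are nonzero and parallel, hence not
orthogonal to each other.\<close>

section \<open>The two matrices as one family\<close>

definition pattern :: "int \<Rightarrow> int mat" where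
  "pattern x = mat_of_rows_list 5
     [[1, 0, 1, 1, 1],
      [0, 1, 1, 1, 1],
      [1, 1, 1, 1, x],
      [1, 1, 0, 0, 1],
      [1, 1, 0, 0, 1]]"

lemma dim_pattern [simp]: "dim_row (pattern x) = 5" "dim_col (pattern x) = 5"
  by (simp_all add: pattern_def mat_of_rows_list_def)

lemma less_5_iff: "i < 5 \<longleftrightarrow> i = 0 \<or> i = 1 \<or> i = 2 \<or> i = 3 \<or> i = (4 :: nat)"
  by auto

lemma lessThan_5: "{..<5} = {0, 1, 2, 3, 4 :: nat}"
  by (auto simp: less_5_iff)

lemma Collect_less_5:
  "{i. i < 5 \<and> Q i} = (if Q 0 then {0} else {}) \<union> (if Q 1 then {1} else {}) \<union>
     (if Q 2 then {2} else {}) \<union> (if Q 3 then {3} else {}) \<union> (if Q 4 then {4 :: nat} else {})"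
  by (auto simp: less_5_iff intro: gr0I)

lemma all_less_5: "(\<forall>i < 5. Q i) \<longleftrightarrow> Q 0 \<and> Q 1 \<and> Q 2 \<and> Q 3 \<and> Q (4 :: nat)"
  by (auto simp: less_5_iff)

lemma pattern_index:
  assumes "i < 5" "j < 5"
  shows "pattern x $$ (i, j) =
    [[1, 0, 1, 1, 1], [0, 1, 1, 1, 1], [1, 1, 1, 1, x], [1, 1, 0, 0, 1], [1, 1, 0, 0, 1]] ! i ! j"
  using assms by (simp add: pattern_def mat_of_rows_list_def)

section \<open>Equivalence to a symmetric matrix\<close>

lemma permutation_mat_mult:
  fixes M :: "int mat"
  assumes "p permutes {..<n}" "M \<in> carrier_mat n m"
  shows "mat n n (\<lambda>(i, j). if j = p i then 1 else 0) * M = mat n m (\<lambda>(i, j). M $$ (p i, j))"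
proof (rule eq_matI)
  fix i j
  assume "i < dim_row (mat n m (\<lambda>(i, j). M $$ (p i, j)))"
    "j < dim_col (mat n m (\<lambda>(i, j). M $$ (p i, j)))"
  then have ij: "i < n" "j < m" by auto
  have "p i < n" using permutes_in_image[OF assms(1), of i] ij by simp
  then show "(mat n n (\<lambda>(i, j). if j = p i then 1 else 0) * M) $$ (i, j) =
      mat n m (\<lambda>(i, j). M $$ (p i, j)) $$ (i, j)"
    using ij assms(2) by (simp add: scalar_prod_def if_distrib[where f = "\<lambda>t. t * _"] cong: if_cong)
qed (use assms(2) in auto)

lemma mat_equivalent_permute_rows:
  assumes "zero_one_mat M" "p permutes {..<dim_row M}"
  shows "mat_equivalent M (mat (dim_row M) (dim_col M) (\<lambda>(i, j). M $$ (p i, j)))"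
    (is "mat_equivalent M ?N")
proof -
  have in_rows: "p i < dim_row M" if "i < dim_row M" for i
    using permutes_in_image[OF assms(2), of i] that by simp
  have "elements_mat ?N \<subseteq> elements_mat M"
    using in_rows by (fastforce simp: elements_mat_def)
  then have "zero_one_mat ?N"
    using assms(1) by (auto simp: zero_one_mat_def)
  moreover have "permutation_mat (dim_row M)
      (mat (dim_row M) (dim_row M) (\<lambda>(i, j). if j = p i then 1 else 0))"
    using assms(2) by (auto simp: permutation_mat_def)
  moreover have "permutation_mat (dim_col M) (1\<^sub>m (dim_col M))"
    unfolding permutation_mat_def
    by (rule exI[of _ id]) (auto simp: permutes_id one_mat_def)
  moreover have "mat (dim_row M) (dim_row M) (\<lambda>(i, j). if j = p i then 1 else 0) * M
      * 1\<^sub>m (dim_col M) = ?N"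
    by (subst permutation_mat_mult[OF assms(2), of M "dim_col M"]) auto
  ultimately show ?thesis
    using assms(1) unfolding mat_equivalent_def by blast
qed

lemma pattern_equivalent_symmetric:
  assumes "x \<in> {0, 1}"
  shows "\<exists>N. symmetric_matrix N \<and> mat_equivalent (pattern x) N"
proof -
  (* This cycle sends 2, 3, 4 to 3, 4, 2, so row 2, the only row that may have a zero in
     column 4, ends up last, and the two equal rows stand where the two equal columns are. *)
  define p :: "nat \<Rightarrow> nat" where "p = transpose 2 3 \<circ> transpose 3 4"
  have p: "p permutes {..<5}"
    unfolding p_def by (intro permutes_compose permutes_swap_id) auto
  have p_vals: "p 0 = 0" "p 1 = 1" "p 2 = 3" "p 3 = 4" "p 4 = 2"
    by (simp_all add: p_def transpose_def)
  have "zero_one_mat (pattern x)"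
    using assms by (auto simp: zero_one_mat_def elements_mat_def pattern_index less_5_iff)
  then have "mat_equivalent (pattern x) (mat 5 5 (\<lambda>(i, j). pattern x $$ (p i, j)))"
    using mat_equivalent_permute_rows[of "pattern x" p] p by simp
  moreover have "symmetric_matrix (mat 5 5 (\<lambda>(i, j). pattern x $$ (p i, j)))"
    unfolding symmetric_matrix_def
    by (rule eq_matI) (auto simp: less_5_iff p_vals pattern_index simp flip: One_nat_def)
  ultimately show ?thesis by blast
qed

section \<open>Strong quadrangularity\<close>

lemma card_ones_in_rows:
  fixes M :: "int mat"
  assumes "S \<subseteq> {..<n}"
  shows "card S \<le> card {i \<in> S. M $$ (i, j) = 1} + card {i. i < n \<and> M $$ (i, j) \<noteq> 1}"
proof -
  have fin: "finite S" using assms finite_subset by blast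
  have "card S \<le> card ({i \<in> S. M $$ (i, j) = 1} \<union> {i. i < n \<and> M $$ (i, j) \<noteq> 1})"
    using assms by (intro card_mono) (auto simp: fin)
  also have "\<dots> \<le> card {i \<in> S. M $$ (i, j) = 1} + card {i. i < n \<and> M $$ (i, j) \<noteq> 1}"
    by (rule card_Un_le)
  finally show ?thesis .
qed

text \<open>The defining condition concerns how many ones a set \<open>S\<close> of rows catches in a column. That is
at least \<open>card S\<close> minus the number of entries of the column that are not one, so only the two-row
sets depend on where those entries are.\<close>

lemma row_strongly_quadrangular_if_few_zeros:
  assumes dim: "dim_row M = 5" "dim_col M = 5"
    and two: "\<forall>j<5. card {i. i < 5 \<and> M $$ (i, j) \<noteq> 1} \<le> 2"
    and one: "3 \<le> card {j. j < 5 \<and> card {i. i < 5 \<and> M $$ (i, j) \<noteq> 1} \<le> 1}"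
    and pairs: "\<forall>u<5. \<forall>v<5. u \<noteq> v \<longrightarrow> 2 \<le> card {j. j < 5 \<and> M $$ (u, j) = 1 \<and> M $$ (v, j) = 1}"
  shows "row_strongly_quadrangular M"
  unfolding row_strongly_quadrangular_def dim
proof (intro allI impI)
  fix S :: "nat set"
  assume S: "S \<subseteq> {..<5}" and nonorth: "\<forall>u\<in>S. \<exists>v\<in>S. v \<noteq> u \<and> row M u \<bullet> row M v \<noteq> 0"
  have fin: "finite S" using S finite_subset by blast
  have "card S \<le> 5" using card_mono[OF _ S] by simp
  let ?C = "{j. j < 5 \<and> 2 \<le> card {i \<in> S. M $$ (i, j) = 1}}"
  consider "card S = 0" | "card S = 1" | "card S = 2" | "card S = 3" | "4 \<le> card S"
    by linarith
  then show "card S \<le> card ?C"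
  proof cases
    case 2
    then obtain u where "S = {u}" by (auto simp: card_1_singleton_iff)
    then show ?thesis using nonorth by simp
  next
    case 3
    then obtain u v where uv: "S = {u, v}" "u \<noteq> v" by (auto simp: card_2_iff)
    have "2 \<le> card {i \<in> S. M $$ (i, j) = 1}" if "M $$ (u, j) = 1" "M $$ (v, j) = 1" for j
    proof -
      have "{i \<in> S. M $$ (i, j) = 1} = S" using that uv by auto
      then show ?thesis using 3 by simp
    qed
    then have "card {j. j < 5 \<and> M $$ (u, j) = 1 \<and> M $$ (v, j) = 1} \<le> card ?C"
      by (intro card_mono) auto
    moreover have "2 \<le> card {j. j < 5 \<and> M $$ (u, j) = 1 \<and> M $$ (v, j) = 1}"
      using pairs uv S by auto
    ultimately show ?thesis using 3 by linarith
  next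
    case 4
    have "2 \<le> card {i \<in> S. M $$ (i, j) = 1}"
      if "card {i. i < 5 \<and> M $$ (i, j) \<noteq> 1} \<le> 1" for j
      using card_ones_in_rows[OF S, of M j] that 4 by linarith
    then have "card {j. j < 5 \<and> card {i. i < 5 \<and> M $$ (i, j) \<noteq> 1} \<le> 1} \<le> card ?C"
      by (intro card_mono) auto
    then show ?thesis using one 4 by linarith
  next
    case 5
    have "2 \<le> card {i \<in> S. M $$ (i, j) = 1}" if "j < 5" for j
    proof -
      have "card {i. i < 5 \<and> M $$ (i, j) \<noteq> 1} \<le> 2" using two that by blast
      then show ?thesis using card_ones_in_rows[OF S, of M j] 5 by linarith
    qed
    then have "?C = {..<5}" by auto
    then show ?thesis using \<open>card S \<le> 5\<close> by simp
  qed simp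
qed

lemma pattern_strongly_quadrangular: "strongly_quadrangular (pattern x)"
  unfolding strongly_quadrangular_def
proof
  show "row_strongly_quadrangular (pattern x)"
    by (rule row_strongly_quadrangular_if_few_zeros)
      (simp_all add: all_less_5 Collect_less_5 pattern_index)
  show "row_strongly_quadrangular (transpose_mat (pattern x))"
    by (rule row_strongly_quadrangular_if_few_zeros)
      (simp_all add: all_less_5 Collect_less_5 pattern_index)
qed

section \<open>No unitary has this pattern\<close>

lemma unitary_rows_orthogonal:
  assumes "unitary_mat U" "U \<in> carrier_mat n n" "i < n" "k < n" "i \<noteq> k"
  shows "(\<Sum>j<n. U $$ (i, j) * cnj (U $$ (k, j))) = 0"
proof -
  have "(U * mat_adjoint U) $$ (i, k) = 0"
    using assms by (simp add: unitary_mat_def)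
  moreover have "(U * mat_adjoint U) $$ (i, k) = (\<Sum>j<n. U $$ (i, j) * cnj (U $$ (k, j)))"
    using assms(2-4) by (simp add: scalar_prod_def mat_adjoint_def mat_of_rows_def
        cols_def atLeast0LessThan)
  ultimately show ?thesis by simp
qed

text \<open>The four equations give \<open>(r, s, t) = t w\<close> and \<open>(r', s', t') = t' w\<close> for the single
vector \<open>w = (- cnj (b / a), - cnj (d / c), 1)\<close>, whose norm is positive.\<close>

lemma orthogonal_to_two_sparse_vectors_not_orthogonal:
  fixes a b c d r s t r' s' t' :: complex
  assumes "a \<noteq> 0" "c \<noteq> 0" "t \<noteq> 0" "t' \<noteq> 0"
    and "a * cnj r + b * cnj t = 0" "a * cnj r' + b * cnj t' = 0"
    and "c * cnj s + d * cnj t = 0" "c * cnj s' + d * cnj t' = 0"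
  shows "r * cnj r' + s * cnj s' + t * cnj t' \<noteq> 0"
proof -
  have solve: "q = - cnj (g / e) * v" if "e \<noteq> 0" "e * cnj q + g * cnj v = 0" for e g q v :: complex
  proof -
    have "cnj q = - (g / e) * cnj v"
      using that by (simp add: field_simps add_eq_0_iff)
    then have "cnj (cnj q) = cnj (- (g / e) * cnj v)" by (rule arg_cong)
    then show ?thesis by simp
  qed
  have "r * cnj r' + s * cnj s' + t * cnj t' =
      t * cnj t' * (cnj (b / a) * (b / a) + cnj (d / c) * (d / c) + 1)"
    using solve[OF assms(1,5)] solve[OF assms(1,6)] solve[OF assms(2,7)] solve[OF assms(2,8)]
    by (simp add: algebra_simps)
  also have "cnj (b / a) * (b / a) + cnj (d / c) * (d / c) + 1 =
      complex_of_real ((cmod (b / a))\<^sup>2 + (cmod (d / c))\<^sup>2 + 1)"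
    unfolding of_real_add complex_norm_square by (simp add: mult.commute)
  also have "t * cnj t' * \<dots> \<noteq> 0"
  proof -
    have "(cmod (b / a))\<^sup>2 + (cmod (d / c))\<^sup>2 + 1 > 0"
      by (simp add: add_nonneg_pos)
    then show ?thesis
      using assms(3,4) by (simp del: of_real_add)
  qed
  finally show ?thesis .
qed

lemma pattern_not_supports_unitaries: "\<not> supports_unitaries (pattern x)"
proof
  assume "supports_unitaries (pattern x)"
  then obtain U where U: "U \<in> carrier_mat 5 5" "unitary_mat U"
    and supp: "\<And>i j. i < 5 \<Longrightarrow> j < 5 \<Longrightarrow> U $$ (i, j) \<noteq> 0 \<longleftrightarrow> pattern x $$ (i, j) = 1"
    by (auto simp: supports_unitaries_def)
  have zero: "U $$ (0, 1) = 0" "U $$ (1, 0) = 0"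
    "U $$ (3, 2) = 0" "U $$ (3, 3) = 0" "U $$ (4, 2) = 0" "U $$ (4, 3) = 0"
    using supp[of 0 1] supp[of 1 0] supp[of 3 2] supp[of 3 3] supp[of 4 2] supp[of 4 3]
    by (simp_all add: pattern_index)
  have nonzero: "U $$ (0, 0) \<noteq> 0" "U $$ (1, 1) \<noteq> 0" "U $$ (3, 4) \<noteq> 0" "U $$ (4, 4) \<noteq> 0"
    using supp[of 0 0] supp[of 1 1] supp[of 3 4] supp[of 4 4]
    by (simp_all add: pattern_index)
  note orth = unitary_rows_orthogonal[OF U(2,1), unfolded lessThan_5]
  have "U $$ (0, 0) * cnj (U $$ (3, 0)) + U $$ (0, 4) * cnj (U $$ (3, 4)) = 0"
    using orth[of 0 3] zero by simp
  moreover have "U $$ (0, 0) * cnj (U $$ (4, 0)) + U $$ (0, 4) * cnj (U $$ (4, 4)) = 0"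
    using orth[of 0 4] zero by simp
  moreover have "U $$ (1, 1) * cnj (U $$ (3, 1)) + U $$ (1, 4) * cnj (U $$ (3, 4)) = 0"
    using orth[of 1 3] zero by simp
  moreover have "U $$ (1, 1) * cnj (U $$ (4, 1)) + U $$ (1, 4) * cnj (U $$ (4, 4)) = 0"
    using orth[of 1 4] zero by simp
  ultimately have "U $$ (3, 0) * cnj (U $$ (4, 0)) + U $$ (3, 1) * cnj (U $$ (4, 1))
      + U $$ (3, 4) * cnj (U $$ (4, 4)) \<noteq> 0"
    by (rule orthogonal_to_two_sparse_vectors_not_orthogonal[OF nonzero])
  then show False
    using orth[of 3 4] zero by (simp add: add.assoc)
qed

theorem corollary3p7:
  fixes M :: "int mat"
  assumes "M \<in> {mat_of_rows_list 5
                  [[1, 0, 1, 1, 1],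
                   [0, 1, 1, 1, 1],
                   [1, 1, 1, 1, 0],
                   [1, 1, 0, 0, 1],
                   [1, 1, 0, 0, 1]],
                mat_of_rows_list 5
                  [[1, 0, 1, 1, 1],
                   [0, 1, 1, 1, 1],
                   [1, 1, 1, 1, 1],
                   [1, 1, 0, 0, 1],
                   [1, 1, 0, 0, 1]]}"
  shows "(\<exists>N. symmetric_matrix N \<and> mat_equivalent M N) \<and>
         strongly_quadrangular M \<and> \<not> supports_unitaries M"
proof -
  obtain x where "x \<in> {0, 1}" "M = pattern x"
    using assms by (auto simp: pattern_def)
  then show ?thesis
    using pattern_equivalent_symmetric pattern_strongly_quadrangular
      pattern_not_supports_unitaries by blast
qed

end
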